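(* Let $p \in (0,1)$ with $p \leq 3/4$, let $q \in [0,1]$, and let $(X_n)_{n \geq 1}$ be the elephant random walk with memory parameter $p$ and first-step parameter $q$. Let $N(0,1)$ denote the standard normal distribution. (a) If $p < 3/4$, then $$\sqrt{3-4p}\,\frac{X_n}{\sqrt{n}} \to N(0,1) \quad \text{in distribution as } n \to \infty.$$ (b) If $p = 3/4$, then $$\frac{X_n}{\sqrt{n \log n}} \to N(0,1) \quad \text{in distribution as } n \to \infty.$$
   Context: Elephant random walk (ERW) with memory parameter $p \in (0,1)$ and first-step parameter $q \in [0,1]$: the process on $\mathbb{Z}$ with $X_0 = 0$ and $X_{n+1} = X_n + \eta_{n+1}$, i.e. $X_n = \sum_{k=1}^n \eta_k$, where the steps $\eta_k \in \{-1,+1\}$ are generated as follows. The first step satisfies $\mathbb{P}(\eta_1 = 1) = q$ and $\mathbb{P}(\eta_1 = -1) = 1-q$. For $n \geq 1$, at time $n+1$ an index $n'$ is chosen uniformly at random from $\{1,\dots,n\}$ (each with probability $1/n$), and then $\eta_{n+1} = \eta_{n'}$ with probability $p$ and $\eta_{n+1} = -\eta_{n'}$ with probability $1-p$. Equivalently, for $n \geq 1$ and $\eta \in \{-1,+1\}$, $$\mathbb{P}[\eta_{n+1} = \eta \mid \eta_1,\dots,\eta_n] = \frac{1}{2n}\sum_{k=1}^n \left[1 + (2p-1)\eta_k \eta\right].$$ *)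

theory Defs
  imports "HOL-Probability.Probability"
begin

text \<open>
  The law of the next step given that the first \<open>n\<close> steps were \<open>h 1, \<dots>, h n\<close>:
  a uniformly chosen remembered step is repeated with probability \<open>p\<close> and
  reversed with probability \<open>1 - p\<close>.
\<close>

definition memory_step :: "real \<Rightarrow> nat \<Rightarrow> (nat \<Rightarrow> int) \<Rightarrow> int pmf" where
  "memory_step p n h =
     bind_pmf (pmf_of_set {1..n}) (\<lambda>k.
     bind_pmf (bernoulli_pmf p) (\<lambda>b.
     return_pmf (if b then h k else - h k)))"

text \<open>
  Steps are indexed from 1; nothing is assumed about \<open>\<eta> 0\<close>. As the history
  \<open>\<eta> 1, \<dots>, \<eta> n\<close> takes finitely many values, its conditional law is determined by
  elementary conditional probabilities given histories of positive probability.
\<close>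

locale elephant_random_walk = prob_space M
  for M :: "'a measure" and p q :: real and \<eta> :: "nat \<Rightarrow> 'a \<Rightarrow> int" +
  assumes memory_param: "p \<in> {0<..<1}"
    and first_param: "q \<in> {0..1}"
    and measurable_step: "\<And>n. n \<ge> 1 \<Longrightarrow> \<eta> n \<in> measurable M (count_space UNIV)"
    and step_values: "\<And>n \<omega>. n \<ge> 1 \<Longrightarrow> \<omega> \<in> space M \<Longrightarrow> \<eta> n \<omega> \<in> {-1, 1}"
    and first_step_up: "\<P>(\<omega> in M. \<eta> 1 \<omega> = 1) = q"
    and first_step_down: "\<P>(\<omega> in M. \<eta> 1 \<omega> = -1) = 1 - q"
    and next_step: "\<And>n h e. n \<ge> 1 \<Longrightarrow> \<P>(\<omega> in M. \<forall>k\<in>{1..n}. \<eta> k \<omega> = h k) > 0 \<Longrightarrow>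
          \<P>(\<omega> in M. \<eta> (n + 1) \<omega> = e \<bar> \<forall>k\<in>{1..n}. \<eta> k \<omega> = h k)
            = pmf (memory_step p n h) e"

definition walk :: "(nat \<Rightarrow> 'a \<Rightarrow> int) \<Rightarrow> nat \<Rightarrow> 'a \<Rightarrow> int" where
  "walk \<eta> n \<omega> = (\<Sum>k=1..n. \<eta> k \<omega>)"

lemma pmf_memory_step:
  assumes "0 \<le> p" "p \<le> 1" "n \<ge> 1"
    and h: "\<And>k. k \<in> {1..n} \<Longrightarrow> h k \<in> {-1, 1}" and e: "e \<in> {-1, 1}"
  shows "pmf (memory_step p n h) e =
           1 / (2 * real n) * (\<Sum>k=1..n. 1 + (2 * p - 1) * real_of_int (h k) * real_of_int e)"
proof -
  have "pmf (memory_step p n h) e =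
      (\<Sum>k=1..n. pmf (bind_pmf (bernoulli_pmf p) (\<lambda>b. return_pmf (if b then h k else - h k))) e) / real n"
    unfolding memory_step_def using assms(3) by (subst pmf_bind_pmf_of_set) auto
  also have "\<dots> = (\<Sum>k=1..n. (1 + (2 * p - 1) * real_of_int (h k) * real_of_int e) / 2) / real n"
  proof (intro arg_cong2[where f="(/)"] sum.cong refl)
    fix k assume "k \<in> {1..n}"
    from h[OF this] e assms(1,2)
    show "pmf (bind_pmf (bernoulli_pmf p) (\<lambda>b. return_pmf (if b then h k else - h k))) e
        = (1 + (2 * p - 1) * real_of_int (h k) * real_of_int e) / 2"
      by (auto simp: pmf_bind field_simps)
  qed
  finally show ?thesis
    by (simp add: sum_divide_distrib[symmetric] field_simps)
qed

lemma (in elephant_random_walk) next_step_prob: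
  assumes n: "n \<ge> 1" and pos: "\<P>(\<omega> in M. \<forall>k\<in>{1..n}. \<eta> k \<omega> = h k) > 0"
    and e: "e \<in> {-1, 1}"
  shows "\<P>(\<omega> in M. \<eta> (n + 1) \<omega> = e \<bar> \<forall>k\<in>{1..n}. \<eta> k \<omega> = h k) =
           1 / (2 * real n) * (\<Sum>k=1..n. 1 + (2 * p - 1) * real_of_int (h k) * real_of_int e)"
proof -
  have "{\<omega> \<in> space M. \<forall>k\<in>{1..n}. \<eta> k \<omega> = h k} \<noteq> {}"
    using pos by (metis less_irrefl measure_empty)
  then obtain \<omega> where "\<omega> \<in> space M" "\<forall>k\<in>{1..n}. \<eta> k \<omega> = h k" by blast
  then have "h k \<in> {-1, 1}" if "k \<in> {1..n}" for k
    using step_values[of k \<omega>] that by auto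
  then show ?thesis
    using next_step[OF n pos] pmf_memory_step[of p n h e] memory_param n e by auto
qed

end

theory Submission
  imports Defs "HOL-Real_Asymp.Real_Asymp"
begin

text \<open>
  Write \<open>a = 2p - 1\<close>, so that the step after time \<open>n\<close> has conditional mean \<open>a X\<^sub>n / n\<close>. Then
  \<open>c\<^sub>n X\<^sub>n\<close> with \<open>c\<^sub>n = \<Prod>\<^sub>j\<^sub><\<^sub>n (1 + a / j)\<^sup>-\<^sup>1\<close> is a martingale whose conditional variances are
  \<open>c\<^sub>k\<^sup>2 (1 - a\<^sup>2 X\<^sub>k\<^sub>-\<^sub>1\<^sup>2 / (k - 1)\<^sup>2)\<close>, hence asymptotically deterministic because
  \<open>E X\<^sub>n\<^sup>2 = o(n\<^sup>2)\<close>. Replacing one increment at a time by a Gaussian factor, the characteristic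
  function of \<open>c\<^sub>n X\<^sub>n / \<surd>V\<^sub>n\<close>, where \<open>V\<^sub>n = \<Sum>\<^sub>k\<^sub>\<le>\<^sub>n c\<^sub>k\<^sup>2\<close>, is seen to converge to the Gaussian one.
  The norming follows from \<open>n c\<^sub>n\<^sup>2 / V\<^sub>n \<rightarrow> 1 - 2a = 3 - 4p\<close>, obtained by telescoping \<open>n c\<^sub>n\<^sup>2\<close>.
\<close>

section \<open>Weighted averages of null sequences\<close>

text \<open>Toeplitz's lemma: the finitely many early terms are swamped by the diverging total
  weight, and the later ones are uniformly small.\<close>

lemma weighted_average_tendsto_zero:
  fixes w \<epsilon> :: "nat \<Rightarrow> real"
  assumes w: "\<And>k. w k \<ge> 0"
    and W: "filterlim (\<lambda>n. \<Sum>k=1..n. w k) at_top sequentially"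
    and eps: "\<epsilon> \<longlonglongrightarrow> 0"
  shows "(\<lambda>n. (\<Sum>k=1..n. w k * \<epsilon> k) / (\<Sum>k=1..n. w k)) \<longlonglongrightarrow> 0"
proof (rule tendstoI)
  fix r :: real assume r: "r > 0"
  obtain K where K: "\<And>k. k \<ge> K \<Longrightarrow> \<bar>\<epsilon> k\<bar> < r / 2"
    using LIMSEQ_D[OF eps, of "r / 2"] r by auto
  define A where "A = (\<Sum>k<K. w k * \<bar>\<epsilon> k\<bar>)"
  have A: "A \<ge> 0"
    unfolding A_def by (intro sum_nonneg mult_nonneg_nonneg w) auto
  \<comment> \<open>Beyond this threshold the total weight is positive and the early part
    \<open>A\<close> takes up less than \<open>r / 2\<close> of it; the tail takes up at most the
    other \<open>r / 2\<close>.\<close>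
  have "\<forall>\<^sub>F n in sequentially. (\<Sum>k=1..n. w k) > 2 * A / r + 1"
    using W by (auto simp: filterlim_at_top_dense)
  then show "\<forall>\<^sub>F n in sequentially.
    dist ((\<Sum>k=1..n. w k * \<epsilon> k) / (\<Sum>k=1..n. w k)) 0 < r"
  proof eventually_elim
    case (elim n)
    let ?V = "\<Sum>k=1..n. w k"
    have "2 * A / r \<ge> 0"
      using A r by simp
    with elim have V: "?V > 0" by linarith
    have AV: "A < r / 2 * ?V"
      using elim r by (simp add: field_simps)
    have "\<bar>\<Sum>k=1..n. w k * \<epsilon> k\<bar> \<le> (\<Sum>k=1..n. w k * \<bar>\<epsilon> k\<bar>)"
      by (rule order.trans[OF sum_abs]) (simp add: abs_mult w)
    also have "\<dots> \<le> (\<Sum>k=1..n. (if k < K then w k * \<bar>\<epsilon> k\<bar> else 0) + r / 2 * w k)"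
    proof (rule sum_mono)
      fix k
      show "w k * \<bar>\<epsilon> k\<bar> \<le> (if k < K then w k * \<bar>\<epsilon> k\<bar> else 0) + r / 2 * w k"
      proof (cases "k < K")
        case False
        then show ?thesis
          using mult_left_mono[OF less_imp_le[OF K[of k]] w[of k]] by (simp add: mult.commute)
      qed (use r w[of k] in simp)
    qed
    also have "\<dots> = (\<Sum>k\<in>{1..n} \<inter> {..<K}. w k * \<bar>\<epsilon> k\<bar>) + r / 2 * ?V"
      by (simp add: sum.distrib sum.inter_restrict sum_distrib_left)
    also have "(\<Sum>k\<in>{1..n} \<inter> {..<K}. w k * \<bar>\<epsilon> k\<bar>) \<le> A"
      unfolding A_def by (intro sum_mono2) (auto intro: mult_nonneg_nonneg w)
    finally have "\<bar>\<Sum>k=1..n. w k * \<epsilon> k\<bar> < r * ?V"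
      using AV by linarith
    then show ?case
      using V by (simp add: field_simps)
  qed
qed

section \<open>Martingale coefficients and norming constants\<close>

text \<open>For \<open>n >= 1\<close> and \<open>a > -1\<close> this is
  \<open>Gamma n * Gamma (1 + a) / Gamma (n + a)\<close>, of order
  \<open>n powr (-a)\<close>.\<close>

definition mart_coeff :: "real \<Rightarrow> nat \<Rightarrow> real" where
  "mart_coeff a n = (\<Prod>j=1..<n. 1 / (1 + a / real j))"

definition mart_var :: "real \<Rightarrow> nat \<Rightarrow> real" where
  "mart_var a n = (\<Sum>k=1..n. (mart_coeff a k)\<^sup>2)"

text \<open>The range of \<open>a = 2 * p - 1\<close> for \<open>0 < p <= 3 / 4\<close>. The lower
  bound keeps the factors of \<open>c\<close> positive; the upper one makes \<open>V\<close>
  diverge.\<close>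

locale memory_coeff =
  fixes a :: real
  assumes a_gt: "-1 < a" and a_le: "a \<le> 1 / 2"
begin

abbreviation "c \<equiv> mart_coeff a"
abbreviation "V \<equiv> mart_var a"

lemma factor_pos: "n \<ge> 1 \<Longrightarrow> 1 + a / real n > 0"
  using a_gt by (simp add: field_simps)

lemma mart_coeff_1: "c 1 = 1"
  by (simp add: mart_coeff_def)

lemma mart_coeff_Suc:
  assumes "n \<ge> 1"
  shows "c n = c (Suc n) * (1 + a / real n)"
proof -
  have "c (Suc n) = c n * (1 / (1 + a / real n))"
    unfolding mart_coeff_def using assms by (simp add: prod.atLeastLessThan_Suc)
  then show ?thesis
    using factor_pos[OF assms] by simp
qed

lemma mart_coeff_pos: "c n > 0"
  unfolding mart_coeff_def by (intro prod_pos) (auto intro!: divide_pos_pos factor_pos)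

lemma mart_coeff_sq_Suc:
  assumes "n \<ge> 1"
  shows "(c n)\<^sup>2 = (c (Suc n))\<^sup>2 * (1 + a / real n)\<^sup>2"
  using mart_coeff_Suc[OF assms] by (simp add: power_mult_distrib)

text \<open>The shift \<open>1 / 4\<close> is the smallest one for which the induction step holds for all \<open>n\<close> at \<open>a = 1 / 2\<close>.\<close>

lemma mart_coeff_sq_ge:
  assumes "n \<ge> 1"
  shows "(real n - 1 / 4) * (c n)\<^sup>2 \<ge> 3 / 4"
  using assms
proof (induction n rule: nat_induct_at_least)
  case base
  then show ?case using mart_coeff_1 by simp
next
  case (Suc n)
  have "(1 + a / real n)\<^sup>2 \<le> (1 + 1 / (2 * real n))\<^sup>2"
    using factor_pos[OF Suc.hyps] a_le Suc.hyps by (intro power_mono) (auto simp: field_simps)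
  then have "(real n - 1 / 4) * (1 + a / real n)\<^sup>2 \<le> (real n - 1 / 4) * (1 + 1 / (2 * real n))\<^sup>2"
    using Suc.hyps by (intro mult_left_mono) auto
  \<comment> \<open>The terms in \<open>1 / n\<close> cancel, and the two sides differ by
    \<open>1 / (16 * n^2)\<close>.\<close>
  also have "\<dots> \<le> real (Suc n) - 1 / 4"
    using Suc.hyps by (simp add: field_simps power2_eq_square)
  finally have "(c (Suc n))\<^sup>2 * ((real n - 1 / 4) * (1 + a / real n)\<^sup>2)
      \<le> (c (Suc n))\<^sup>2 * (real (Suc n) - 1 / 4)"
    by (rule mult_left_mono) simp
  then show ?case
    using Suc.IH mart_coeff_sq_Suc[OF Suc.hyps] by (simp add: mult_ac)
qed

lemma mart_coeff_sq_ge': "n \<ge> 1 \<Longrightarrow> real n * (c n)\<^sup>2 \<ge> 3 / 4"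
  using mart_coeff_sq_ge[of n] by (simp add: left_diff_distrib) (smt (verit) zero_le_power2)

text \<open>Comparison with the harmonic series, since \<open>c k\<close> squared is at least
  \<open>3 / (4 * k)\<close>.\<close>

lemma mart_var_at_top: "filterlim V at_top sequentially"
proof (rule filterlim_at_top_mono)
  show "filterlim (\<lambda>n. 3 / 4 * harm n :: real) at_top sequentially"
    by (rule filterlim_tendsto_pos_mult_at_top[OF tendsto_const _ harm_at_top]) simp
  show "\<forall>\<^sub>F n in sequentially. 3 / 4 * harm n \<le> V n"
  proof (intro always_eventually allI)
    fix n
    show "3 / 4 * harm n \<le> V n"
      unfolding mart_var_def harm_def sum_distrib_left
    proof (rule sum_mono)
      fix k assume "k \<in> {1..n}"
      then show "3 / 4 * inverse (real k) \<le> (c k)\<^sup>2"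
        using mart_coeff_sq_ge'[of k] by (simp add: field_simps)
    qed
  qed
qed

lemma mart_var_mono: "m \<le> n \<Longrightarrow> V m \<le> V n"
  unfolding mart_var_def by (intro sum_mono2) auto

lemma mart_var_pos: "n \<ge> 1 \<Longrightarrow> V n > 0"
  using mart_var_mono[of 1 n] mart_coeff_1 by (simp add: mart_var_def)

lemma scaled_coeff_sq_diff:
  assumes "n \<ge> 1"
  shows "real (Suc n) * (c (Suc n))\<^sup>2 - real n * (c n)\<^sup>2
    = (c (Suc n))\<^sup>2 * (1 - 2 * a - a\<^sup>2 / real n)"
proof -
  have "real n * (1 + a / real n)\<^sup>2 = real n + 2 * a + a\<^sup>2 / real n"
    using assms by (simp add: field_simps power2_eq_square)
  then have "real n * (c n)\<^sup>2 = (c (Suc n))\<^sup>2 * (real n + 2 * a + a\<^sup>2 / real n)"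
    by (metis mart_coeff_sq_Suc[OF assms] mult.left_commute)
  then show ?thesis
    by (simp add: algebra_simps)
qed

text \<open>Telescoping of \<open>scaled_coeff_sq_diff\<close>. For \<open>k = 1\<close> the
  quotient by \<open>real k - 1 = 0\<close> has value 0, so that summand is
  \<open>1 - 2 * a\<close>; adding \<open>2 * a\<close> restores the true initial value 1.\<close>

lemma scaled_coeff_sq_eq:
  "real n * (c n)\<^sup>2 = (\<Sum>k=1..n. (c k)\<^sup>2 * (1 - 2 * a - a\<^sup>2 / (real k - 1)))
    + (if n = 0 then 0 else 2 * a)"
proof (induction n)
  case (Suc n)
  then show ?case
    using scaled_coeff_sq_diff[of n] mart_coeff_1 by (cases "n = 0") simp_all
qed simp

text \<open>After division of the telescoped identity by \<open>V n\<close>, the corrections form a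
  weighted average of the null sequence \<open>a^2 / (k - 1)\<close>, and the boundary term
  \<open>2 * a / V n\<close> vanishes.\<close>

lemma scaled_coeff_sq_over_mart_var: "(\<lambda>n. real n * (c n)\<^sup>2 / V n) \<longlonglongrightarrow> 1 - 2 * a"
proof -
  have "(\<lambda>n. (1 - 2 * a) + - ((\<Sum>k=1..n. (c k)\<^sup>2 * (a\<^sup>2 / (real k - 1))) / V n) + 2 * a / V n)
      \<longlonglongrightarrow> (1 - 2 * a) + - 0 + 0"
  proof (intro tendsto_add tendsto_minus tendsto_const)
    show "(\<lambda>n. (\<Sum>k=1..n. (c k)\<^sup>2 * (a\<^sup>2 / (real k - 1))) / V n) \<longlonglongrightarrow> 0"
      unfolding mart_var_def
    proof (rule weighted_average_tendsto_zero)
      show "(\<lambda>k. a\<^sup>2 / (real k - 1)) \<longlonglongrightarrow> 0" by real_asymp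
    qed (use mart_var_at_top in \<open>auto simp: mart_var_def[abs_def]\<close>)
    show "(\<lambda>n. 2 * a / V n) \<longlonglongrightarrow> 0"
      by (rule tendsto_divide_0[OF tendsto_const filterlim_at_top_imp_at_infinity[OF mart_var_at_top]])
  qed
  moreover have "\<forall>\<^sub>F n in sequentially.
      (1 - 2 * a) + - ((\<Sum>k=1..n. (c k)\<^sup>2 * (a\<^sup>2 / (real k - 1))) / V n) + 2 * a / V n
        = real n * (c n)\<^sup>2 / V n"
    using eventually_ge_at_top[of 1]
  proof eventually_elim
    case (elim n)
    have "real n * (c n)\<^sup>2 = (1 - 2 * a) * V n - (\<Sum>k=1..n. (c k)\<^sup>2 * (a\<^sup>2 / (real k - 1))) + 2 * a"
      using elim unfolding scaled_coeff_sq_eq[of n] mart_var_def sum_distrib_left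
      by (simp add: sum_subtractf[symmetric] algebra_simps)
    then show ?case
      using mart_var_pos[OF elim] by (simp add: field_simps)
  qed
  ultimately show ?thesis
    by (auto elim: Lim_transform_eventually)
qed

text \<open>Asymptotic negligibility of a single increment, in the role of a Lindeberg condition:
  the square is a convergent sequence times \<open>1 / n\<close>.\<close>

lemma mart_coeff_over_sqrt_mart_var: "(\<lambda>n. c n / sqrt (V n)) \<longlonglongrightarrow> 0"
proof -
  have "(\<lambda>n. sqrt ((real n * (c n)\<^sup>2 / V n) * (1 / real n))) \<longlonglongrightarrow> sqrt ((1 - 2 * a) * 0)"
    by (intro tendsto_intros scaled_coeff_sq_over_mart_var)
  moreover have "\<forall>\<^sub>F n in sequentially.
      sqrt ((real n * (c n)\<^sup>2 / V n) * (1 / real n)) = c n / sqrt (V n)"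
    using eventually_ge_at_top[of 1]
    by eventually_elim (simp add: real_sqrt_divide less_imp_le[OF mart_coeff_pos])
  ultimately show ?thesis
    by (auto elim: Lim_transform_eventually)
qed

lemma norming_subcritical:
  assumes "a < 1 / 2"
  shows "(\<lambda>n. sqrt (1 - 2 * a) / sqrt (real n) * (sqrt (V n) / c n)) \<longlonglongrightarrow> 1"
proof -
  have "(\<lambda>n. sqrt ((1 - 2 * a) / (real n * (c n)\<^sup>2 / V n))) \<longlonglongrightarrow> sqrt ((1 - 2 * a) / (1 - 2 * a))"
    using assms by (intro tendsto_intros scaled_coeff_sq_over_mart_var) auto
  moreover have "sqrt ((1 - 2 * a) / (real n * (c n)\<^sup>2 / V n))
      = sqrt (1 - 2 * a) / sqrt (real n) * (sqrt (V n) / c n)" for n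
    by (simp add: real_sqrt_divide real_sqrt_mult less_imp_le[OF mart_coeff_pos])
  ultimately show ?thesis
    using assms by simp
qed

text \<open>At \<open>a = 1 / 2\<close> the sequence \<open>n c\<^sub>n\<^sup>2\<close> decreases to a positive limit \<open>L\<close>, whence
  \<open>V\<^sub>n = \<Sum>\<^sub>k (k c\<^sub>k\<^sup>2) / k\<close> is asymptotic to \<open>L ln n\<close>.\<close>

lemma norming_critical:
  assumes a: "a = 1 / 2"
  shows "(\<lambda>n. 1 / sqrt (real n * ln (real n)) * (sqrt (V n) / c n)) \<longlonglongrightarrow> 1"
proof -
  define W where "W n = real n * (c n)\<^sup>2" for n
  \<comment> \<open>At \<open>a = 1 / 2\<close> the main term \<open>1 - 2 * a\<close> of the
    difference vanishes and a negative one remains. The shift avoids \<open>W 0 = 0\<close>, which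
    lies below \<open>W 1 = 1\<close>.\<close>
  have dec: "decseq (\<lambda>n. W (Suc n))"
  proof (rule decseq_SucI)
    fix n
    have "(c (Suc (Suc n)))\<^sup>2 * (1 - 2 * a - a\<^sup>2 / real (Suc n)) \<le> 0"
      unfolding a by (intro mult_nonneg_nonpos) auto
    then show "W (Suc (Suc n)) \<le> W (Suc n)"
      using scaled_coeff_sq_diff[of "Suc n"] unfolding W_def by simp
  qed
  have ge: "3 / 4 \<le> W (Suc n)" for n
    using mart_coeff_sq_ge'[of "Suc n"] unfolding W_def by simp
  obtain L where L: "(\<lambda>n. W (Suc n)) \<longlonglongrightarrow> L"
    using decseq_convergent[OF dec] ge by blast
  have L_pos: "L > 0"
    using LIMSEQ_le_const[OF L, of "3 / 4"] ge by fastforce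
  have WL: "W \<longlonglongrightarrow> L"
    using L by (simp add: filterlim_sequentially_Suc)
  \<comment> \<open>As the square of \<open>c k\<close> is \<open>W k / k\<close>,
    \<open>V n\<close> is a harmonic sum with weights \<open>W k\<close>; replacing each by
    \<open>L\<close> costs only \<open>o(harm n)\<close>.\<close>
  have avg: "(\<lambda>n. (\<Sum>k=1..n. inverse (real k) * (W k - L)) / (\<Sum>k=1..n. inverse (real k))) \<longlonglongrightarrow> 0"
  proof (rule weighted_average_tendsto_zero)
    show "(\<lambda>k. W k - L) \<longlonglongrightarrow> 0"
      using WL by (simp add: LIM_zero)
    show "filterlim (\<lambda>n. \<Sum>k=1..n. inverse (real k)) at_top sequentially"
      using harm_at_top by (simp add: harm_def[abs_def])
  qed simp
  have V_eq: "V n = (\<Sum>k=1..n. inverse (real k) * (W k - L)) + L * harm n" for n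
    unfolding mart_var_def W_def harm_def sum_distrib_left
    by (simp add: sum.distrib[symmetric] field_simps)
  have harm_nz: "harm n \<noteq> (0::real)" if "n \<ge> 1" for n
    using that ln_gt_zero_iff[of "real n + 1"] harm_ge_ln[of n] by linarith
  have VH: "(\<lambda>n. V n / harm n) \<longlonglongrightarrow> L"
  proof (rule Lim_transform_eventually)
    show "(\<lambda>n. (\<Sum>k=1..n. inverse (real k) * (W k - L)) / (\<Sum>k=1..n. inverse (real k)) + L) \<longlonglongrightarrow> L"
      using tendsto_add[OF avg tendsto_const[of L]] by simp
    show "\<forall>\<^sub>F n in sequentially. (\<Sum>k=1..n. inverse (real k) * (W k - L))
        / (\<Sum>k=1..n. inverse (real k)) + L = V n / harm n"
      using eventually_ge_at_top[of 1]
    proof eventually_elim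
      case (elim n)
      then show ?case
        using harm_nz[OF elim] unfolding V_eq harm_def by (simp add: field_simps)
    qed
  qed
  have Hln: "(\<lambda>n. harm n / ln (real n)) \<longlonglongrightarrow> 1"
  proof (rule Lim_transform_eventually)
    have "(\<lambda>n. 1 / ln (real n)) \<longlonglongrightarrow> 0" by real_asymp
    then show "(\<lambda>n. (harm n - ln (real n)) * (1 / ln (real n)) + 1) \<longlonglongrightarrow> 1"
      using tendsto_add[OF tendsto_mult[OF euler_mascheroni_LIMSEQ] tendsto_const] by fastforce
    show "\<forall>\<^sub>F n in sequentially. (harm n - ln (real n)) * (1 / ln (real n)) + 1 = harm n / ln (real n)"
      using eventually_gt_at_top[of 1] by eventually_elim (simp add: field_simps)
  qed
  have "(\<lambda>n. sqrt ((V n / harm n) * (harm n / ln (real n)) / W n)) \<longlonglongrightarrow> sqrt (L * 1 / L)"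
    using L_pos by (intro tendsto_intros VH Hln WL) auto
  moreover have "\<forall>\<^sub>F n in sequentially. sqrt ((V n / harm n) * (harm n / ln (real n)) / W n)
      = 1 / sqrt (real n * ln (real n)) * (sqrt (V n) / c n)"
    using eventually_ge_at_top[of 1]
  proof eventually_elim
    case (elim n)
    have "(V n / harm n) * (harm n / ln (real n)) / W n = V n / (real n * ln (real n) * (c n)\<^sup>2)"
      using harm_nz[OF elim] by (simp add: W_def field_simps)
    then show ?case
      by (simp add: real_sqrt_divide real_sqrt_mult less_imp_le[OF mart_coeff_pos])
  qed
  ultimately show ?thesis
    using L_pos by (auto elim: Lim_transform_eventually)
qed

end

section \<open>Taylor estimates for a single step\<close>

text \<open>With \<open>x = u^2 / 2\<close> the error is at most \<open>x\<close> and at most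
  \<open>x^2 / 2\<close>. The second bound serves for \<open>\<bar>u\<bar> \<le> 1\<close>, the
  first for larger \<open>u\<close>.\<close>

lemma exp_minus_linear_error:
  fixes u :: real
  shows "\<bar>exp (- u\<^sup>2 / 2) - (1 - u\<^sup>2 / 2)\<bar> \<le> \<bar>u\<bar> ^ 3"
proof -
  define x where "x = u\<^sup>2 / 2"
  have x: "x \<ge> 0" by (simp add: x_def)
  have lower: "1 - x \<le> exp (- x)"
    using exp_ge_add_one_self[of "- x"] by simp
  have "exp (- x) \<le> 1 - x + x\<^sup>2 / 2"
  proof -
    have pos: "1 + x + x\<^sup>2 / 2 > 0" using x by (simp add: add_pos_nonneg)
    have "exp (- x) \<le> 1 / (1 + x + x\<^sup>2 / 2)"
      using exp_lower_Taylor_quadratic[OF x] pos by (simp add: exp_minus divide_simps)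
    also have "\<dots> \<le> 1 - x + x\<^sup>2 / 2"
    proof -
      have "(1 - x + x\<^sup>2 / 2) * (1 + x + x\<^sup>2 / 2) = 1 + x ^ 4 / 4"
        by (simp add: field_simps power2_eq_square power4_eq_xxxx)
      then show ?thesis using pos by (simp add: divide_le_eq)
    qed
    finally show ?thesis .
  qed
  then have err: "\<bar>exp (- x) - (1 - x)\<bar> \<le> min x (x\<^sup>2 / 2)"
    using lower x by auto
  have "min x (x\<^sup>2 / 2) \<le> \<bar>u\<bar> ^ 3"
  proof (cases "\<bar>u\<bar> \<le> 1")
    case True
    have "x\<^sup>2 / 2 = \<bar>u\<bar> ^ 4 / 8" by (simp add: x_def power_divide power_mult[symmetric])
    also have "\<dots> \<le> \<bar>u\<bar> ^ 4" by simp
    also have "\<dots> \<le> \<bar>u\<bar> ^ 3"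
      using True by (intro power_decreasing) auto
    finally show ?thesis by simp
  next
    case False
    have "x \<le> \<bar>u\<bar> ^ 2" by (simp add: x_def)
    also have "\<dots> \<le> \<bar>u\<bar> ^ 3"
      using False by (intro power_increasing) auto
    finally show ?thesis by simp
  qed
  from order.trans[OF err this] show ?thesis by (simp only: x_def minus_divide_left)
qed

text \<open>The first two terms form the characteristic function at \<open>u\<close> of a centred variable of
  variance \<open>1 - y\<^sup>2\<close>, namely a \<open>\<plusminus>1\<close>-valued variable of mean \<open>y\<close> minus its mean.\<close>

lemma centred_sign_char_error:
  fixes u y :: real
  assumes y: "\<bar>y\<bar> \<le> 1"
  shows "cmod (((1 + y) / 2) *\<^sub>R iexp (u * (1 - y)) + ((1 - y) / 2) *\<^sub>R iexp (- u * (1 + y))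
      - of_real (exp (- u\<^sup>2 / 2))) \<le> u\<^sup>2 * y\<^sup>2 / 2 + 3 * \<bar>u\<bar> ^ 3"
proof -
  \<comment> \<open>Second-order Taylor remainder. It is evaluated at \<open>u * s\<close> with
    \<open>s\<close> either \<open>1 - y\<close> or \<open>-(1 + y)\<close>, so
    \<open>\<bar>s\<bar> \<le> 2\<close> and the constant is \<open>8 / 6\<close>.\<close>
  define R where "R z = iexp z - (1 + \<i> * of_real z - of_real (z\<^sup>2 / 2))" for z :: real
  have R: "cmod (R z) \<le> \<bar>z\<bar> ^ 3 / 6" for z
    using iexp_approx1[of z 2]
    by (simp add: R_def numeral_2_eq_2 fact_numeral numeral_3_eq_3 power_mult_distrib algebra_simps)
  have Rle: "cmod (R (u * s)) \<le> 4 / 3 * \<bar>u\<bar> ^ 3" if "\<bar>s\<bar> \<le> 2" for s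
  proof -
    have "\<bar>s\<bar> ^ 3 \<le> 2 ^ 3"
      using that by (intro power_mono) auto
    then have "\<bar>u\<bar> ^ 3 * \<bar>s\<bar> ^ 3 \<le> \<bar>u\<bar> ^ 3 * 8"
      by (intro mult_left_mono) auto
    then show ?thesis
      using R[of "u * s"] by (simp add: abs_mult power_mult_distrib)
  qed
  let ?p = "(1 + y) / 2" and ?q = "(1 - y) / 2"
  let ?z = "u * (1 - y)" and ?w = "u * (- (1 + y))"
  have iexp_eq: "iexp z = R z + (1 + \<i> * of_real z - of_real (z\<^sup>2 / 2))" for z
    by (simp add: R_def)
  \<comment> \<open>The mean is zero, so linear terms cancel; the variance \<open>1 - y^2\<close>
    falls short of the Gaussian variance 1 by \<open>y^2\<close>, which leaves
    \<open>u^2 * y^2 / 2\<close>.\<close>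
  have "?p *\<^sub>R iexp ?z + ?q *\<^sub>R iexp ?w - of_real (exp (- u\<^sup>2 / 2))
      = (?p *\<^sub>R R ?z + ?q *\<^sub>R R ?w) + of_real (u\<^sup>2 * y\<^sup>2 / 2)
        - of_real (exp (- u\<^sup>2 / 2) - (1 - u\<^sup>2 / 2))"
    unfolding iexp_eq by (simp add: scaleR_conv_of_real field_simps power2_eq_square)
  also have "cmod \<dots> \<le> (?p * cmod (R ?z) + ?q * cmod (R ?w)) + u\<^sup>2 * y\<^sup>2 / 2
      + \<bar>exp (- u\<^sup>2 / 2) - (1 - u\<^sup>2 / 2)\<bar>"
    using y by (intro norm_triangle_le norm_triangle_le_diff add_mono) (auto simp: norm_mult norm_power simp del: of_real_diff)
  also have "\<dots> \<le> (?p * (4 / 3 * \<bar>u\<bar> ^ 3) + ?q * (4 / 3 * \<bar>u\<bar> ^ 3)) + u\<^sup>2 * y\<^sup>2 / 2 + \<bar>u\<bar> ^ 3"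
    using y by (intro add_mono mult_left_mono Rle exp_minus_linear_error order.refl) auto
  also have "\<dots> = u\<^sup>2 * y\<^sup>2 / 2 + 7 / 3 * \<bar>u\<bar> ^ 3"
    by (simp add: field_simps)
  also have "\<dots> \<le> u\<^sup>2 * y\<^sup>2 / 2 + 3 * \<bar>u\<bar> ^ 3"
    by simp
  finally show ?thesis by (simp only: mult_minus_left mult_minus_right)
qed

text \<open>A Cesaro mean of \<open>1 / k\<close>: the weighted average with unit weights.\<close>

lemma harm_over_n_tendsto_zero: "(\<lambda>n. harm n / real n) \<longlonglongrightarrow> 0"
  using weighted_average_tendsto_zero[of "\<lambda>_. 1" "\<lambda>k. inverse (real k)"]
  by (simp add: harm_def filterlim_real_sequentially LIMSEQ_inverse_real_of_nat
      tendsto_inverse_0_at_top)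

section \<open>Histories and the conditional law of the next step\<close>

context elephant_random_walk
begin

abbreviation "X n \<omega> \<equiv> real_of_int (walk \<eta> n \<omega>)"

definition history :: "nat \<Rightarrow> (nat \<Rightarrow> int) \<Rightarrow> 'a set" where
  "history n h = {\<omega> \<in> space M. \<forall>k\<in>{1..n}. \<eta> k \<omega> = h k}"

lemma step_event [measurable]: "n \<ge> 1 \<Longrightarrow> {\<omega> \<in> space M. \<eta> n \<omega> = e} \<in> events"
  using measurable_sets[OF measurable_step[of n], of "{e}"] by (simp add: vimage_def Int_def conj_commute)

lemma history_event: "history n h \<in> events"
  unfolding history_def by (intro sets.sets_Collect_finite_All step_event) auto

text \<open>The histories with values in \<open>{-1, 1}\<close> partition the space into finitely
  many events on which the walk is constant; extensional functions make the matching
  \<open>h\<close> unique. \<open>B\<close> is left free so that it can be an event about the next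
  step.\<close>

lemma has_integral_history:
  fixes F :: "int \<Rightarrow> 'b :: {banach, second_countable_topology}"
  assumes B: "B \<in> events"
  shows "has_bochner_integral M (\<lambda>\<omega>. indicator B \<omega> *\<^sub>R F (walk \<eta> n \<omega>))
    (\<Sum>h\<in>{1..n} \<rightarrow>\<^sub>E {-1, 1}. prob (history n h \<inter> B) *\<^sub>R F (\<Sum>k=1..n. h k))"
proof -
  let ?H = "{1..n} \<rightarrow>\<^sub>E {-1, 1 :: int}"
  have fin: "finite ?H" by (intro finite_PiE) auto
  have "has_bochner_integral M
      (\<lambda>\<omega>. \<Sum>h\<in>?H. indicator (history n h \<inter> B) \<omega> *\<^sub>R F (\<Sum>k=1..n. h k))
      (\<Sum>h\<in>?H. prob (history n h \<inter> B) *\<^sub>R F (\<Sum>k=1..n. h k))"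
    by (intro has_bochner_integral_sum has_bochner_integral_indicator)
       (auto intro: history_event B simp: emeasure_eq_measure)
  moreover have "(\<Sum>h\<in>?H. indicator (history n h \<inter> B) \<omega> *\<^sub>R F (\<Sum>k=1..n. h k))
      = indicator B \<omega> *\<^sub>R F (walk \<eta> n \<omega>)" if \<omega>: "\<omega> \<in> space M" for \<omega>
  proof -
    define g where "g = restrict (\<lambda>k. \<eta> k \<omega>) {1..n}"
    have g: "g \<in> ?H"
      unfolding g_def restrict_PiE_iff using step_values[OF _ \<omega>] by auto
    have iff: "\<omega> \<in> history n h \<longleftrightarrow> h = g" if "h \<in> ?H" for h
    proof
      assume "\<omega> \<in> history n h"
      then show "h = g"
        using that g by (intro PiE_ext[of _ "{1..n}"]) (auto simp: history_def g_def)
    qed (use \<omega> in \<open>auto simp: history_def g_def\<close>)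
    have "(\<Sum>h\<in>?H. indicator (history n h \<inter> B) \<omega> *\<^sub>R F (\<Sum>k=1..n. h k))
        = (\<Sum>h\<in>?H. if h = g then indicator B \<omega> *\<^sub>R F (\<Sum>k=1..n. h k) else 0)"
      by (intro sum.cong refl) (auto simp: iff indicator_def)
    also have "\<dots> = indicator B \<omega> *\<^sub>R F (\<Sum>k=1..n. g k)"
      using g fin by (simp add: sum.delta')
    also have "(\<Sum>k=1..n. g k) = walk \<eta> n \<omega>"
      by (simp add: g_def walk_def)
    finally show ?thesis .
  qed
  ultimately show ?thesis
    by (subst has_bochner_integral_cong[OF refl _ refl]) auto
qed

lemma
  fixes F :: "int \<Rightarrow> 'b :: {banach, second_countable_topology}"
  shows integrable_walk: "integrable M (\<lambda>\<omega>. F (walk \<eta> n \<omega>))"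
    and expectation_walk: "(LINT \<omega>|M. F (walk \<eta> n \<omega>))
      = (\<Sum>h\<in>{1..n} \<rightarrow>\<^sub>E {-1, 1}. prob (history n h) *\<^sub>R F (\<Sum>k=1..n. h k))"
proof -
  have "history n h \<inter> space M = history n h" for h
    by (auto simp: history_def)
  then have "has_bochner_integral M (\<lambda>\<omega>. F (walk \<eta> n \<omega>))
      (\<Sum>h\<in>{1..n} \<rightarrow>\<^sub>E {-1, 1}. prob (history n h) *\<^sub>R F (\<Sum>k=1..n. h k))"
    using has_integral_history[OF sets.top, of F n]
    by (subst has_bochner_integral_cong[where g = "\<lambda>\<omega>. indicator (space M) \<omega> *\<^sub>R F (walk \<eta> n \<omega>)", OF refl _ refl])
       auto
  then show "integrable M (\<lambda>\<omega>. F (walk \<eta> n \<omega>))"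
    and "(LINT \<omega>|M. F (walk \<eta> n \<omega>))
      = (\<Sum>h\<in>{1..n} \<rightarrow>\<^sub>E {-1, 1}. prob (history n h) *\<^sub>R F (\<Sum>k=1..n. h k))"
    by (simp_all add: has_bochner_integral_iff)
qed

text \<open>The conditional law depends on the history only through its sum. This lets the walk
  itself carry all the conditioning.\<close>

lemma prob_history_step:
  assumes n: "n \<ge> 1" and e: "e \<in> {-1, 1}"
  shows "prob (history n h \<inter> {\<omega> \<in> space M. \<eta> (Suc n) \<omega> = e})
    = prob (history n h) * ((1 + (2 * p - 1) * real_of_int (\<Sum>k=1..n. h k) / real n * real_of_int e) / 2)"
\<comment> \<open>Null histories lie outside the scope of \<open>next_step\<close>; for them both
  sides vanish.\<close>
proof (cases "prob (history n h) = 0")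
  case True
  have "prob (history n h \<inter> {\<omega> \<in> space M. \<eta> (Suc n) \<omega> = e}) \<le> prob (history n h)"
    by (intro finite_measure_mono history_event) auto
  with True show ?thesis
    by (simp add: measure_le_0_iff)
next
  case False
  then have pos: "prob (history n h) > 0"
    by (simp add: zero_less_measure_iff)
  have *: "{\<omega> \<in> space M. \<eta> (n + 1) \<omega> = e \<and> (\<forall>k\<in>{1..n}. \<eta> k \<omega> = h k)}
      = history n h \<inter> {\<omega> \<in> space M. \<eta> (Suc n) \<omega> = e}"
    by (auto simp: history_def)
  have "prob (history n h \<inter> {\<omega> \<in> space M. \<eta> (Suc n) \<omega> = e}) / prob (history n h)
      = 1 / (2 * real n) * (\<Sum>k=1..n. 1 + (2 * p - 1) * real_of_int (h k) * real_of_int e)"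
    using next_step_prob[OF n _ e, of h] pos unfolding cond_prob_def * by (simp add: history_def)
  also have "(\<Sum>k=1..n. 1 + (2 * p - 1) * real_of_int (h k) * real_of_int e)
      = real n + (2 * p - 1) * real_of_int (\<Sum>k=1..n. h k) * real_of_int e"
    by (simp add: sum.distrib sum_distrib_left sum_distrib_right)
  also have "1 / (2 * real n) * \<dots>
      = (1 + (2 * p - 1) * real_of_int (\<Sum>k=1..n. h k) / real n * real_of_int e) / 2"
    using n by (simp add: field_simps)
  finally show ?thesis
    using pos by (simp add: field_simps)
qed

text \<open>Integrates out the next step: split along its two values, expand over histories, and
  weight each value by its conditional probability. This takes the place of conditional expectation
  below.\<close>

lemma expectation_step:
  fixes G :: "int \<Rightarrow> int \<Rightarrow> 'b :: {banach, second_countable_topology}"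
  assumes n: "n \<ge> 1"
  shows "(LINT \<omega>|M. G (walk \<eta> n \<omega>) (\<eta> (Suc n) \<omega>))
    = (LINT \<omega>|M. ((1 + (2 * p - 1) * X n \<omega> / real n) / 2) *\<^sub>R G (walk \<eta> n \<omega>) 1
        + ((1 - (2 * p - 1) * X n \<omega> / real n) / 2) *\<^sub>R G (walk \<eta> n \<omega>) (-1))"
proof -
  let ?B = "\<lambda>e. {\<omega> \<in> space M. \<eta> (Suc n) \<omega> = e}"
  let ?y = "\<lambda>x. (2 * p - 1) * real_of_int x / real n"
  have B: "?B e \<in> events" for e
    by (rule step_event) simp
  have split: "(LINT \<omega>|M. indicator (?B e) \<omega> *\<^sub>R F (walk \<eta> n \<omega>))
      = (LINT \<omega>|M. ((1 + ?y (walk \<eta> n \<omega>) * real_of_int e) / 2) *\<^sub>R F (walk \<eta> n \<omega>))"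
    if e: "e \<in> {-1, 1}" for e and F :: "int \<Rightarrow> 'b"
    unfolding has_bochner_integral_integral_eq[OF has_integral_history[OF B]]
      expectation_walk[of "\<lambda>x. ((1 + ?y x * real_of_int e) / 2) *\<^sub>R F x"]
      prob_history_step[OF n e] scaleR_scaleR ..
  have "(LINT \<omega>|M. G (walk \<eta> n \<omega>) (\<eta> (Suc n) \<omega>))
      = (LINT \<omega>|M. indicator (?B 1) \<omega> *\<^sub>R G (walk \<eta> n \<omega>) 1
          + indicator (?B (-1)) \<omega> *\<^sub>R G (walk \<eta> n \<omega>) (-1))"
  proof (intro Bochner_Integration.integral_cong refl)
    fix \<omega> assume "\<omega> \<in> space M"
    then show "G (walk \<eta> n \<omega>) (\<eta> (Suc n) \<omega>) = indicator (?B 1) \<omega> *\<^sub>R G (walk \<eta> n \<omega>) 1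
          + indicator (?B (-1)) \<omega> *\<^sub>R G (walk \<eta> n \<omega>) (-1)"
      using step_values[of "Suc n" \<omega>] by auto
  qed
  also have "\<dots> = (LINT \<omega>|M. indicator (?B 1) \<omega> *\<^sub>R G (walk \<eta> n \<omega>) 1)
      + (LINT \<omega>|M. indicator (?B (-1)) \<omega> *\<^sub>R G (walk \<eta> n \<omega>) (-1))"
    by (intro Bochner_Integration.integral_add
        has_bochner_integral_integrable has_integral_history B)
       (rule integrable.intros, rule has_integral_history[OF B, of _ "\<lambda>x. G x _"])+
  also have "\<dots> = (LINT \<omega>|M. ((1 + ?y (walk \<eta> n \<omega>)) / 2) *\<^sub>R G (walk \<eta> n \<omega>) 1)
      + (LINT \<omega>|M. ((1 - ?y (walk \<eta> n \<omega>)) / 2) *\<^sub>R G (walk \<eta> n \<omega>) (-1))"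
    using split[of 1 "\<lambda>x. G x 1"] split[of "-1" "\<lambda>x. G x (-1)"] by simp
  also have "\<dots> = (LINT \<omega>|M. ((1 + ?y (walk \<eta> n \<omega>)) / 2) *\<^sub>R G (walk \<eta> n \<omega>) 1
      + ((1 - ?y (walk \<eta> n \<omega>)) / 2) *\<^sub>R G (walk \<eta> n \<omega>) (-1))"
    by (intro Bochner_Integration.integral_add[symmetric]
        integrable_walk[of "\<lambda>x. ((1 + ?y x) / 2) *\<^sub>R G x 1"]
        integrable_walk[of "\<lambda>x. ((1 - ?y x) / 2) *\<^sub>R G x (-1)"])
  finally show ?thesis .
qed

section \<open>Second moments of the walk\<close>

lemma walk_Suc: "walk \<eta> (Suc n) \<omega> = walk \<eta> n \<omega> + \<eta> (Suc n) \<omega>"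
  by (simp add: walk_def)

lemma abs_walk_le: "\<omega> \<in> space M \<Longrightarrow> \<bar>X n \<omega>\<bar> \<le> real n"
proof (induction n)
  case (Suc n)
  then show ?case
    using step_values[of "Suc n" \<omega>] by (auto simp: walk_Suc)
qed (simp add: walk_def)

text \<open>The step has square 1 and conditional mean \<open>(2 * p - 1) * X n / n\<close>, which
  enters through the cross term of the expanded square.\<close>

lemma second_moment_Suc:
  assumes n: "n \<ge> 1"
  shows "expectation (\<lambda>\<omega>. (X (Suc n) \<omega>)\<^sup>2)
    = 1 + (1 + 2 * (2 * p - 1) / real n) * expectation (\<lambda>\<omega>. (X n \<omega>)\<^sup>2)"
proof -
  have "expectation (\<lambda>\<omega>. (X (Suc n) \<omega>)\<^sup>2)
      = expectation (\<lambda>\<omega>. 1 + (1 + 2 * (2 * p - 1) / real n) * (X n \<omega>)\<^sup>2)"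
    unfolding walk_Suc
    by (subst expectation_step[OF n, of "\<lambda>x e. (real_of_int (x + e))\<^sup>2"])
       (intro Bochner_Integration.integral_cong refl,
         use n in \<open>simp add: field_simps power2_eq_square\<close>)
  also have "\<dots> = 1 + (1 + 2 * (2 * p - 1) / real n) * expectation (\<lambda>\<omega>. (X n \<omega>)\<^sup>2)"
    by (subst Bochner_Integration.integral_add)
       (auto intro!: integrable_walk[of "\<lambda>x. (real_of_int x)\<^sup>2"] simp: prob_space)
  finally show ?thesis .
qed

text \<open>For \<open>p <= 3 / 4\<close> the growth factor is at most \<open>(n + 1) / n\<close>,
  and \<open>n * harm n\<close> solves the recursion with that factor exactly. One bound covers both
  regimes and is \<open>o(n^2)\<close>.\<close>

lemma second_moment_le:
  assumes p: "p \<le> 3 / 4" and n: "n \<ge> 1"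
  shows "expectation (\<lambda>\<omega>. (X n \<omega>)\<^sup>2) \<le> real n * harm n"
  using n
proof (induction n rule: nat_induct_at_least)
  case base
  have "expectation (\<lambda>\<omega>. (X 1 \<omega>)\<^sup>2) \<le> expectation (\<lambda>\<omega>. 1)"
    using abs_walk_le[of _ 1]
    by (intro integral_mono integrable_walk[of "\<lambda>x. (real_of_int x)\<^sup>2"]) (auto simp: abs_square_le_1)
  then show ?case
    by (simp add: prob_space harm_def)
next
  case (Suc n)
  have "1 + (1 + 2 * (2 * p - 1) / real n) * expectation (\<lambda>\<omega>. (X n \<omega>)\<^sup>2)
      \<le> 1 + (real (Suc n) / real n) * expectation (\<lambda>\<omega>. (X n \<omega>)\<^sup>2)"
    using p Suc.hyps by (intro add_left_mono mult_right_mono) (auto simp: field_simps)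
  also have "\<dots> \<le> 1 + (real (Suc n) / real n) * (real n * harm n)"
    using Suc.IH by (intro add_left_mono mult_left_mono) auto
  also have "\<dots> = 1 + real (Suc n) * harm n"
    using Suc.hyps by simp
  also have "1 + real (Suc n) * harm n = real (Suc n) * harm (Suc n)"
    by (simp add: harm_Suc distrib_left)
  finally show ?case
    unfolding second_moment_Suc[OF Suc.hyps] .
qed

lemma second_moment_over_square_tendsto_zero:
  assumes p: "p \<le> 3 / 4"
  shows "(\<lambda>n. expectation (\<lambda>\<omega>. (X n \<omega>)\<^sup>2) / (real n)\<^sup>2) \<longlonglongrightarrow> 0"
proof (rule tendsto_sandwich[OF _ _ tendsto_const harm_over_n_tendsto_zero])
  show "\<forall>\<^sub>F n in sequentially. expectation (\<lambda>\<omega>. (X n \<omega>)\<^sup>2) / (real n)\<^sup>2 \<le> harm n / real n"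
    using eventually_ge_at_top[of 1]
  proof eventually_elim
    case (elim n)
    then show ?case
      using second_moment_le[OF p elim] by (simp add: field_simps power2_eq_square)
  qed
qed auto

section \<open>Characteristic functions of the walk\<close>

definition walk_char :: "nat \<Rightarrow> real \<Rightarrow> complex" where
  "walk_char n t = (CLINT \<omega>|M. iexp (t * X n \<omega>))"

text \<open>Centring the increment at its conditional mean \<open>y = (2p - 1) X\<^sub>n / n\<close> moves the frequency
  from \<open>u\<close> to \<open>u (1 + (2p - 1) / n)\<close>; the remaining factor is nearly Gaussian.\<close>

lemma walk_char_step:
  assumes n: "n \<ge> 1"
  shows "cmod (walk_char (Suc n) u - of_real (exp (- u\<^sup>2 / 2)) * walk_char n (u * (1 + (2 * p - 1) / real n)))
    \<le> (2 * p - 1)\<^sup>2 / 2 * (u\<^sup>2 * (expectation (\<lambda>\<omega>. (X n \<omega>)\<^sup>2) / (real n)\<^sup>2)) + 3 * \<bar>u\<bar> ^ 3"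
proof -
  let ?y = "\<lambda>x. (2 * p - 1) * real_of_int x / real n"
  define D where "D x = ((1 + ?y x) / 2) *\<^sub>R iexp (u * (1 - ?y x))
      + ((1 - ?y x) / 2) *\<^sub>R iexp (- u * (1 + ?y x)) - of_real (exp (- u\<^sup>2 / 2))" for x
  define S where "S x = iexp (u * (1 + (2 * p - 1) / real n) * real_of_int x)" for x
  define J where "J x = ((1 + ?y x) / 2) *\<^sub>R iexp (u * real_of_int (x + 1))
      + ((1 - ?y x) / 2) *\<^sub>R iexp (u * real_of_int (x + -1))" for x
  \<comment> \<open>\<open>S\<close> carries the phase \<open>u * (x + ?y x)\<close> and
    \<open>D\<close> the phases \<open>u * (1 - ?y x)\<close> and \<open>u * (-1 - ?y x)\<close>, so
    the conditional means cancel in the product.\<close>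
  have fac: "J x - of_real (exp (- u\<^sup>2 / 2)) * S x = S x * D x" for x
  proof -
    have "S x * iexp (u * (1 - ?y x)) = iexp (u * real_of_int (x + 1))"
      "S x * iexp (- u * (1 + ?y x)) = iexp (u * real_of_int (x + -1))"
      unfolding S_def exp_add[symmetric] using n by (auto intro!: arg_cong[of _ _ exp] simp: field_simps)
    note shift = this[symmetric]
    have "r *\<^sub>R (S x * A) + s *\<^sub>R (S x * B) - E * S x = S x * (r *\<^sub>R A + s *\<^sub>R B - E)"
      for r s :: real and A B E
      by (simp add: algebra_simps)
    then show ?thesis
      unfolding J_def D_def shift .
  qed
  have "walk_char (Suc n) u = (CLINT \<omega>|M. J (walk \<eta> n \<omega>))"
    unfolding walk_char_def walk_Suc J_def
    by (rule expectation_step[OF n, of "\<lambda>x e. iexp (u * real_of_int (x + e))"])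
  moreover have "of_real (exp (- u\<^sup>2 / 2)) * walk_char n (u * (1 + (2 * p - 1) / real n))
      = (CLINT \<omega>|M. of_real (exp (- u\<^sup>2 / 2)) * S (walk \<eta> n \<omega>))"
    unfolding walk_char_def S_def by (rule integral_mult_right_zero[symmetric])
  ultimately have "walk_char (Suc n) u - of_real (exp (- u\<^sup>2 / 2)) * walk_char n (u * (1 + (2 * p - 1) / real n))
      = (CLINT \<omega>|M. J (walk \<eta> n \<omega>) - of_real (exp (- u\<^sup>2 / 2)) * S (walk \<eta> n \<omega>))"
    using Bochner_Integration.integral_diff[OF integrable_walk[of J n]
        integrable_walk[of "\<lambda>x. of_real (exp (- u\<^sup>2 / 2)) * S x" n]]
    by argo
  also have "\<dots> = (CLINT \<omega>|M. S (walk \<eta> n \<omega>) * D (walk \<eta> n \<omega>))"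
    unfolding fac ..
  also have "cmod \<dots> \<le> (LINT \<omega>|M. cmod (S (walk \<eta> n \<omega>) * D (walk \<eta> n \<omega>)))"
    by (rule integral_norm_bound)
  also have "\<dots> \<le> (LINT \<omega>|M. (2 * p - 1)\<^sup>2 / 2 * (u\<^sup>2 / (real n)\<^sup>2) * (X n \<omega>)\<^sup>2 + 3 * \<bar>u\<bar> ^ 3)"
  proof (rule integral_mono)
    show "integrable M (\<lambda>\<omega>. cmod (S (walk \<eta> n \<omega>) * D (walk \<eta> n \<omega>)))"
      by (rule integrable_walk[of "\<lambda>x. cmod (S x * D x)"])
    show "integrable M (\<lambda>\<omega>. (2 * p - 1)\<^sup>2 / 2 * (u\<^sup>2 / (real n)\<^sup>2) * (X n \<omega>)\<^sup>2 + 3 * \<bar>u\<bar> ^ 3)"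
      by (rule integrable_walk[of "\<lambda>x. (2 * p - 1)\<^sup>2 / 2 * (u\<^sup>2 / (real n)\<^sup>2) * (real_of_int x)\<^sup>2 + 3 * \<bar>u\<bar> ^ 3"])
    fix \<omega> assume \<omega>: "\<omega> \<in> space M"
    have "\<bar>2 * p - 1\<bar> * \<bar>X n \<omega>\<bar> \<le> 1 * real n"
      using memory_param by (intro mult_mono abs_walk_le \<omega>) auto
    then have "\<bar>?y (walk \<eta> n \<omega>)\<bar> \<le> 1"
      using n by (simp add: abs_mult)
    from centred_sign_char_error[OF this, of u]
    have D_le: "cmod (D (walk \<eta> n \<omega>)) \<le> u\<^sup>2 * (?y (walk \<eta> n \<omega>))\<^sup>2 / 2 + 3 * \<bar>u\<bar> ^ 3"
      unfolding D_def .
    have "cmod (S (walk \<eta> n \<omega>) * D (walk \<eta> n \<omega>)) = cmod (D (walk \<eta> n \<omega>))"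
      unfolding norm_mult S_def norm_exp_i_times by simp
    then show "cmod (S (walk \<eta> n \<omega>) * D (walk \<eta> n \<omega>))
        \<le> (2 * p - 1)\<^sup>2 / 2 * (u\<^sup>2 / (real n)\<^sup>2) * (X n \<omega>)\<^sup>2 + 3 * \<bar>u\<bar> ^ 3"
      using D_le by (simp add: power_divide power_mult_distrib mult_ac)
  qed
  also have "\<dots> = (2 * p - 1)\<^sup>2 / 2 * (u\<^sup>2 / (real n)\<^sup>2) * expectation (\<lambda>\<omega>. (X n \<omega>)\<^sup>2) + 3 * \<bar>u\<bar> ^ 3"
    using integrable_walk[of "\<lambda>x. (real_of_int x)\<^sup>2" n]
    by (simp add: prob_space)
  finally show ?thesis
    by (simp add: mult_ac)
qed

text \<open>Iterates \<open>walk_char_step\<close>: by the recursion for \<open>c\<close> the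
  frequency \<open>s * c (Suc n)\<close> passes to \<open>s * c n\<close>, and the Gaussian factors
  multiply up to the exponential of \<open>V n\<close>. The terms before the sum pay for the first
  step.\<close>

lemma walk_char_error:
  assumes p: "p \<le> 3 / 4" and n: "n \<ge> 1"
  defines "c \<equiv> mart_coeff (2 * p - 1)" and "V \<equiv> mart_var (2 * p - 1)"
  shows "cmod (walk_char n (s * c n) - exp (- (s\<^sup>2 * V n) / 2))
    \<le> \<bar>s\<bar> + s\<^sup>2 / 2
      + (\<Sum>k=1..n. (2 * p - 1)\<^sup>2 / 2 * ((s * c k)\<^sup>2 * (expectation (\<lambda>\<omega>. (X (k - 1) \<omega>)\<^sup>2) / (real (k - 1))\<^sup>2))
          + 3 * \<bar>s * c k\<bar> ^ 3)"
  using n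
proof (induction n rule: nat_induct_at_least)
  case base
  interpret memory_coeff "2 * p - 1"
    using memory_param p by unfold_locales auto
  have "walk_char 1 s - 1 = (CLINT \<omega>|M. iexp (s * X 1 \<omega>) - 1)"
    unfolding walk_char_def
    by (subst Bochner_Integration.integral_diff,
        rule integrable_walk[of "\<lambda>x. iexp (s * real_of_int x)"]) (simp_all add: prob_space)
  also have "cmod \<dots> \<le> (LINT \<omega>|M. cmod (iexp (s * X 1 \<omega>) - 1))"
    by (rule integral_norm_bound)
  also have "\<dots> \<le> (LINT \<omega>|M. \<bar>s\<bar>)"
  proof (rule integral_mono)
    show "integrable M (\<lambda>\<omega>. cmod (iexp (s * X 1 \<omega>) - 1))"
      by (rule integrable_walk[of "\<lambda>x. cmod (iexp (s * real_of_int x) - 1)"])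
    fix \<omega> assume "\<omega> \<in> space M"
    then have "\<bar>s * X 1 \<omega>\<bar> \<le> \<bar>s\<bar> * 1"
      unfolding abs_mult using abs_walk_le[of \<omega> 1] by (intro mult_left_mono) auto
    then show "cmod (iexp (s * X 1 \<omega>) - 1) \<le> \<bar>s\<bar>"
      using iexp_approx1[of "s * X 1 \<omega>" 0] by simp
  qed simp
  finally have 1: "cmod (walk_char 1 s - 1) \<le> \<bar>s\<bar>"
    by (simp add: prob_space)
  have "1 - s\<^sup>2 / 2 \<le> exp (- s\<^sup>2 / 2)"
    using exp_ge_add_one_self[of "- s\<^sup>2 / 2"] by simp
  then have "cmod (of_real (1 - exp (- s\<^sup>2 / 2))) \<le> s\<^sup>2 / 2"
    unfolding norm_of_real by simp
  then have 2: "cmod (1 - of_real (exp (- s\<^sup>2 / 2))) \<le> s\<^sup>2 / 2"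
    by simp
  \<comment> \<open>Both characteristic functions are compared with 1. The summand
    \<open>k = 1\<close> of the claim, where division by \<open>real 0\<close> gives 0, is
    nonnegative and only weakens the bound.\<close>
  have "cmod (walk_char 1 s - of_real (exp (- s\<^sup>2 / 2))) \<le> \<bar>s\<bar> + s\<^sup>2 / 2"
    using norm_triangle_mono[OF 1 2] by simp
  then show ?case
    using mart_coeff_1 by (simp add: c_def V_def mart_var_def add.commute add_increasing)
next
  case (Suc n)
  interpret memory_coeff "2 * p - 1"
    using memory_param p by unfold_locales auto
  let ?\<theta> = "s * c (Suc n)"
  let ?T = "\<lambda>k. (2 * p - 1)\<^sup>2 / 2 * ((s * c k)\<^sup>2 * (expectation (\<lambda>\<omega>. (X (k - 1) \<omega>)\<^sup>2) / (real (k - 1))\<^sup>2))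
      + 3 * \<bar>s * c k\<bar> ^ 3"
  have theta: "?\<theta> * (1 + (2 * p - 1) / real n) = s * c n"
    using mart_coeff_Suc[OF Suc.hyps] by (simp add: c_def)
  have split: "exp (- (s\<^sup>2 * V (Suc n)) / 2) = exp (- ?\<theta>\<^sup>2 / 2) * exp (- (s\<^sup>2 * V n) / 2)"
    unfolding exp_add[symmetric]
    by (simp add: V_def c_def mart_var_def power_mult_distrib field_simps)
  \<comment> \<open>The Gaussian factor is at most 1, so errors made earlier are not
    amplified.\<close>
  have "cmod (of_real (exp (- ?\<theta>\<^sup>2 / 2)) * walk_char n (s * c n)
        - of_real (exp (- ?\<theta>\<^sup>2 / 2) * exp (- (s\<^sup>2 * V n) / 2)))
      \<le> 1 * cmod (walk_char n (s * c n) - exp (- (s\<^sup>2 * V n) / 2))"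
    unfolding of_real_mult right_diff_distrib[symmetric] norm_mult
    by (intro mult_right_mono) auto
  then have "cmod (of_real (exp (- ?\<theta>\<^sup>2 / 2)) * walk_char n (s * c n)
        - exp (- (s\<^sup>2 * V (Suc n)) / 2)) \<le> \<bar>s\<bar> + s\<^sup>2 / 2 + sum ?T {1..n}"
    using Suc.IH unfolding split by simp
  from norm_triangle_mono[OF walk_char_step[OF Suc.hyps, of ?\<theta>, unfolded theta] this]
  show ?case
    by (simp add: add_ac)
qed

text \<open>With \<open>s = \<sigma> n / sqrt (V n)\<close> the error sum becomes two weighted
  averages of null sequences with weights \<open>c k\<close> squared. Letting
  \<open>\<sigma>\<close> vary with \<open>n\<close> absorbs the norming constants, in place of
  Slutsky's theorem.\<close>

lemma walk_char_tendsto: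
  assumes p: "p \<le> 3 / 4"
  defines "c \<equiv> mart_coeff (2 * p - 1)" and "V \<equiv> mart_var (2 * p - 1)"
  assumes \<sigma>: "\<sigma> \<longlonglongrightarrow> t"
  shows "(\<lambda>n. walk_char n (\<sigma> n / sqrt (V n) * c n)) \<longlonglongrightarrow> exp (- t\<^sup>2 / 2)"
proof -
  interpret memory_coeff "2 * p - 1"
    rewrites "mart_coeff (2 * p - 1) = c" and "mart_var (2 * p - 1) = V"
    using memory_param p by (unfold_locales, auto simp: c_def V_def)
  define \<epsilon> where "\<epsilon> k = expectation (\<lambda>\<omega>. (X (k - 1) \<omega>)\<^sup>2) / (real (k - 1))\<^sup>2" for k
  define \<delta> where "\<delta> k = c k / sqrt (V k)" for k
  define avg where "avg g n = (\<Sum>k=1..n. (c k)\<^sup>2 * g k) / V n" for g :: "nat \<Rightarrow> real" and n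
  have avg: "avg g \<longlonglongrightarrow> 0" if "g \<longlonglongrightarrow> 0" for g
    using weighted_average_tendsto_zero[OF _ _ that, of "\<lambda>k. (c k)\<^sup>2"] mart_var_at_top
    unfolding avg_def[abs_def] V_def mart_var_def[abs_def] c_def by simp
  have eps: "\<epsilon> \<longlonglongrightarrow> 0"
  proof -
    have "(\<lambda>n. \<epsilon> (Suc n)) \<longlonglongrightarrow> 0"
      using second_moment_over_square_tendsto_zero[OF p] by (simp add: \<epsilon>_def)
    then show ?thesis by (simp only: filterlim_sequentially_Suc)
  qed
  have delta: "\<delta> \<longlonglongrightarrow> 0"
    using mart_coeff_over_sqrt_mart_var by (simp add: \<delta>_def[abs_def])
  define err where "err n = \<bar>\<sigma> n / sqrt (V n)\<bar> + (\<sigma> n / sqrt (V n))\<^sup>2 / 2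
      + ((2 * p - 1)\<^sup>2 / 2 * (\<sigma> n)\<^sup>2 * avg \<epsilon> n + 3 * \<bar>\<sigma> n\<bar> ^ 3 * avg \<delta> n)" for n
  have "filterlim (\<lambda>n. sqrt (V n)) at_top sequentially"
    by (rule filterlim_compose[OF sqrt_at_top mart_var_at_top])
  then have s0: "(\<lambda>n. \<sigma> n / sqrt (V n)) \<longlonglongrightarrow> 0"
    by (intro tendsto_divide_0[OF \<sigma>] filterlim_at_top_imp_at_infinity)
  have "err \<longlonglongrightarrow> \<bar>0\<bar> + 0\<^sup>2 / 2 + ((2 * p - 1)\<^sup>2 / 2 * t\<^sup>2 * 0 + 3 * \<bar>t\<bar> ^ 3 * 0)"
    unfolding err_def[abs_def] by (intro tendsto_intros s0 \<sigma> avg eps delta) auto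
  then have err0: "err \<longlonglongrightarrow> 0" by simp
  have bound: "cmod (walk_char n (\<sigma> n / sqrt (V n) * c n) - exp (- (\<sigma> n)\<^sup>2 / 2)) \<le> err n"
    if n: "n \<ge> 1" for n
  proof -
    let ?s = "\<sigma> n / sqrt (V n)"
    have Vn: "V n > 0" by (rule mart_var_pos[OF n])
    have sV: "?s\<^sup>2 = (\<sigma> n)\<^sup>2 / V n"
      using Vn by (simp add: power_divide)
    \<comment> \<open>One factor \<open>c k / sqrt (V n)\<close> is enlarged to
      \<open>\<delta> k\<close> by \<open>V k \<le> V n\<close>; this quantity depends on
      \<open>k\<close> alone and can be averaged.\<close>
    have third: "\<bar>?s * c k\<bar> ^ 3 \<le> \<bar>\<sigma> n\<bar> ^ 3 * ((c k)\<^sup>2 * \<delta> k / V n)" if k: "k \<in> {1..n}" for k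
    proof -
      have Vk: "V k > 0" "V k \<le> V n"
        using k mart_var_pos mart_var_mono by auto
      have "V n = sqrt (V n) * sqrt (V n)"
        using Vn by simp
      then have "\<bar>?s * c k\<bar> ^ 3 = \<bar>\<sigma> n\<bar> ^ 3 * ((c k)\<^sup>2 / V n) * (c k / sqrt (V n))"
        using mart_coeff_pos[of k] Vn
        by (simp add: abs_mult power3_eq_cube power2_eq_square del: abs_mult_self_eq)
      also have "\<dots> \<le> \<bar>\<sigma> n\<bar> ^ 3 * ((c k)\<^sup>2 / V n) * \<delta> k"
        unfolding \<delta>_def using Vk Vn mart_coeff_pos[of k]
        by (intro mult_left_mono divide_left_mono) auto
      finally show ?thesis by simp
    qed
    have "(\<Sum>k=1..n. (2 * p - 1)\<^sup>2 / 2 * ((?s * c k)\<^sup>2 * \<epsilon> k) + 3 * \<bar>?s * c k\<bar> ^ 3)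
        \<le> (\<Sum>k=1..n. (2 * p - 1)\<^sup>2 / 2 * ((\<sigma> n)\<^sup>2 / V n * (c k)\<^sup>2 * \<epsilon> k)
            + 3 * (\<bar>\<sigma> n\<bar> ^ 3 * ((c k)\<^sup>2 * \<delta> k / V n)))"
      unfolding power_mult_distrib sV
      by (intro sum_mono add_mono order.refl mult_left_mono third) auto
    also have "\<dots> = (2 * p - 1)\<^sup>2 / 2 * (\<sigma> n)\<^sup>2 * avg \<epsilon> n + 3 * \<bar>\<sigma> n\<bar> ^ 3 * avg \<delta> n"
      by (simp add: avg_def sum.distrib sum_distrib_left sum_divide_distrib mult_ac)
    finally show ?thesis
      using walk_char_error[OF p n, of ?s] Vn
      unfolding err_def \<epsilon>_def c_def[symmetric] V_def[symmetric] by (simp add: sV)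
  qed
  have "(\<lambda>n. walk_char n (\<sigma> n / sqrt (V n) * c n) - exp (- (\<sigma> n)\<^sup>2 / 2)) \<longlonglongrightarrow> 0"
    by (rule Lim_null_comparison[OF _ err0]) (use bound in \<open>auto intro: eventually_sequentiallyI\<close>)
  moreover have "(\<lambda>n. complex_of_real (exp (- (\<sigma> n)\<^sup>2 / 2))) \<longlonglongrightarrow> exp (- t\<^sup>2 / 2)"
    by (intro tendsto_intros \<sigma>) auto
  ultimately show ?thesis
    by (rule Lim_transform[rotated])
qed

section \<open>Convergence in distribution\<close>

theorem walk_clt:
  assumes p: "p \<le> 3 / 4"
    and b: "(\<lambda>n. b n * (sqrt (mart_var (2 * p - 1) n) / mart_coeff (2 * p - 1) n)) \<longlonglongrightarrow> 1"
  shows "weak_conv_m (\<lambda>n. distr M borel (\<lambda>\<omega>. b n * X n \<omega>)) std_normal_distribution"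
proof (rule levy_continuity)
  interpret memory_coeff "2 * p - 1"
    using memory_param p by unfold_locales auto
  have meas: "(\<lambda>\<omega>. b n * X n \<omega>) \<in> borel_measurable M" for n
    by (rule borel_measurable_integrable, rule integrable_walk[of "\<lambda>x. b n * real_of_int x"])
  then show "real_distribution (distr M borel (\<lambda>\<omega>. b n * X n \<omega>))" for n
    by (rule real_distribution_distr)
  show "real_distribution std_normal_distribution"
    by (rule real_dist_normal_dist)
  fix t
  \<comment> \<open>Chosen so that \<open>?\<sigma> n / sqrt (V n) * c n\<close> is the frequency
    \<open>t * b n\<close> for \<open>n >= 1\<close>; the norming hypothesis gives its limit
    \<open>t\<close>.\<close>
  let ?\<sigma> = "\<lambda>n. t * (b n * (sqrt (V n) / c n))"
  have "?\<sigma> \<longlonglongrightarrow> t"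
    using tendsto_mult_left[OF b, of t] by simp
  from walk_char_tendsto[OF p this]
  have "(\<lambda>n. walk_char n (?\<sigma> n / sqrt (V n) * c n)) \<longlonglongrightarrow> exp (- t\<^sup>2 / 2)" .
  moreover have "\<forall>\<^sub>F n in sequentially. walk_char n (?\<sigma> n / sqrt (V n) * c n)
      = char (distr M borel (\<lambda>\<omega>. b n * X n \<omega>)) t"
    using eventually_ge_at_top[of 1]
  proof eventually_elim
    case (elim n)
    have "?\<sigma> n / sqrt (V n) * c n = t * b n"
      using mart_var_pos[OF elim] mart_coeff_pos[of n] by simp
    then show ?case
      using meas[of n] by (simp add: walk_char_def char_def integral_distr mult.assoc)
  qed
  ultimately show "(\<lambda>n. char (distr M borel (\<lambda>\<omega>. b n * X n \<omega>)) t) \<longlonglongrightarrow> char std_normal_distribution t"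
    unfolding char_std_normal_distribution by (rule Lim_transform_eventually)
qed

end

theorem corollary2:
  fixes M :: "'a measure" and p q :: real and \<eta> :: "nat \<Rightarrow> 'a \<Rightarrow> int"
  assumes "0 < p" "p < 1" "p \<le> 3 / 4" "0 \<le> q" "q \<le> 1"
    and "elephant_random_walk M p q \<eta>"
  shows "(p < 3 / 4 \<longrightarrow>
           weak_conv_m
             (\<lambda>n. distr M borel (\<lambda>\<omega>. sqrt (3 - 4 * p) * (real_of_int (walk \<eta> n \<omega>) / sqrt (real n))))
             std_normal_distribution) \<and>
         (p = 3 / 4 \<longrightarrow>
           weak_conv_m
             (\<lambda>n. distr M borel (\<lambda>\<omega>. real_of_int (walk \<eta> n \<omega>) / sqrt (real n * ln (real n))))
             std_normal_distribution)"
proof -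
  interpret elephant_random_walk M p q \<eta> by fact
  interpret memory_coeff "2 * p - 1"
    using assms by unfold_locales auto
  have "1 - 2 * (2 * p - 1) = 3 - 4 * p" by simp
  then have "weak_conv_m (\<lambda>n. distr M borel (\<lambda>\<omega>. sqrt (3 - 4 * p) / sqrt (real n) * X n \<omega>))
      std_normal_distribution" if "p < 3 / 4"
    using walk_clt[OF \<open>p \<le> 3 / 4\<close> norming_subcritical] that by simp
  moreover have "weak_conv_m (\<lambda>n. distr M borel (\<lambda>\<omega>. 1 / sqrt (real n * ln (real n)) * X n \<omega>))
      std_normal_distribution" if "p = 3 / 4"
    using walk_clt[OF \<open>p \<le> 3 / 4\<close> norming_critical] that by simp
  ultimately show ?thesis
    by (simp add: mult.commute)
qed

end
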